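(* Let $d$ be a non-negative integer (the spline degree) and let $t_{-d}\le t_{-d+1}\le\cdots\le t_{2d+1}$ be a non-decreasing sequence of real knots. The vector of optimal SIAC convolution coefficients $\mathbf{c}:=[c_{-d},\ldots,c_d]^{\mathtt t}\in\mathbb{R}^{2d+1}$, i.e. the vector of coefficients for which the kernel $K(x):=\sum_{\gamma=-d}^{d}c_\gamma B(x|t_{\gamma:\gamma+d+1})$ satisfies $$(K\star(\cdot)^\delta)(x)=x^\delta,\qquad \delta=0,\ldots,2d,$$ for all $x\in\mathbb{R}$, is $$\mathbf{c}:=M_0^{-1}\mathbf{e}_1,\qquad M_0:=\Big[\Delta(t_{\gamma:\gamma+d+1})\,t^{d+1+\delta}\Big]_{\delta=0,\ldots,2d,\ \gamma=-d,\ldots,d}.$$ Here $M_0$ is the real $(2d+1)\times(2d+1)$ matrix with rows indexed by $\delta$ and columns indexed by $\gamma$, whose entries are divided differences of the monomials $t\mapsto t^{d+1+\delta}$, and $\mathbf{e}_1:=[1,0,\ldots,0]^{\mathtt t}\in\mathbb{R}^{2d+1}$ is the first unit vector (its entry $1$ is in the row $\delta=0$).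
   Context: Notation: $t_{i:j}$ denotes the sequence $t_i,t_{i+1},\ldots,t_j$. Divided differences: for a sufficiently smooth univariate real-valued function $h$ with $k$th derivative $h^{(k)}$, set $\Delta(t_i)h:=h(t_i)$ and, for $j>i$, $\Delta(t_{i:j})h:=\big(\Delta(t_{i+1:j})h-\Delta(t_{i:j-1})h\big)/(t_j-t_i)$ if $t_i\neq t_j$, and $\Delta(t_{i:j})h:=h^{(j-i)}(t_i)/(j-i)!$ if $t_i=t_j$. The divided difference acts on the variable $t$, so $\Delta(t_{\gamma:\gamma+d+1})\,t^{d+1+\delta}$ is a real number that depends only on the knots $t_\gamma,\ldots,t_{\gamma+d+1}$. B-splines: for a non-decreasing knot sequence $t_{i:j}$, the B-spline of degree $d$ with knot sequence $t_{i:j}$ is $$B(x|t_{i:j}):=(t_j-t_i)\,\Delta(t_{i:j})\big(\max\{(\cdot-x),0\}\big)^{d},$$ where $\Delta(t_{i:j})$ acts on the function $t\mapsto(\max\{(t-x),0\})^d$ for given $x\in\mathbb{R}$. In the kernel $K$ this is used with $i=\gamma$ and $j=\gamma+d+1$. Convolution: $(f\star g)(x):=\int_{\mathbb{R}}f(t)\,g(x-t)\,dt$ for every $x$ where the integral exists. The symbol $(\cdot)^\delta$ denotes the monomial $t\mapsto t^\delta$.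
   Formalization: As B integrates to (t_{γ+d+1}−t_γ)/(d+1), the formula is false in general (d=0, knots 0,2). Proved for M_0 invertible: ((t_{γ+d+1}−t_γ)/(d+1))c_γ = (M_0^{-1}e_1)_γ; the literal formula if all supports have length d+1; M_0 invertible if no d+3 consecutive knots coincide. *)

theory Defs
  imports
    "HOL-Analysis.Analysis"
    "Jordan_Normal_Form.Gauss_Jordan_Elimination"
begin

text \<open>
  Knots are given by a function on \<^typ>\<open>int\<close>, of which only finitely many values matter.
  The term \<open>divdiff t i k h\<close> is the divided difference \<open>\<Delta>(t\<^sub>i, \<dots>, t\<^sub>j) h\<close> with \<open>j = i + k\<close>;
  the recursion runs over the order \<open>k = j - i\<close>.
\<close>

primrec divdiff :: "(int \<Rightarrow> real) \<Rightarrow> int \<Rightarrow> nat \<Rightarrow> (real \<Rightarrow> real) \<Rightarrow> real" where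
  "divdiff t i 0 h = h (t i)"
| "divdiff t i (Suc k) h =
     (if t i = t (i + int (Suc k))
      then (deriv ^^ Suc k) h (t i) / fact (Suc k)
      else (divdiff t (i + 1) k h - divdiff t i k h) / (t (i + int (Suc k)) - t i))"

text \<open>
  Truncated power \<open>(max {u, 0})\<^sup>d\<close>. For \<open>d = 0\<close> it has to be the Heaviside step;
  the literal \<open>max u 0 ^ 0\<close> would be constantly 1 in HOL and all splines of degree 0 would vanish.
\<close>

definition trunc_pow :: "nat \<Rightarrow> real \<Rightarrow> real" where
  "trunc_pow d u = (if 0 < u then u ^ d else 0)"

text \<open>
  Where a repeated knot asks for a derivative of the truncated power that does not exist
  (only for \<open>x\<close> equal to that knot), the value is unspecified. If \<open>t i = t j\<close>, the spline is 0.
\<close>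

definition bspline :: "nat \<Rightarrow> (int \<Rightarrow> real) \<Rightarrow> int \<Rightarrow> int \<Rightarrow> real \<Rightarrow> real" where
  "bspline d t i j x = (t j - t i) * divdiff t i (nat (j - i)) (\<lambda>s. trunc_pow d (s - x))"

text \<open>The coefficient \<open>c\<^sub>\<gamma>\<close>, \<open>-d \<le> \<gamma> \<le> d\<close>, is stored at position \<open>\<gamma> + d\<close> of a vector of length \<open>2d + 1\<close>.\<close>

definition siac_kernel :: "nat \<Rightarrow> (int \<Rightarrow> real) \<Rightarrow> real vec \<Rightarrow> real \<Rightarrow> real" where
  "siac_kernel d t c x =
     (\<Sum>\<gamma> = - int d..int d.
        vec_index c (nat (\<gamma> + int d)) * bspline d t \<gamma> (\<gamma> + int d + 1) x)"

definition convolution_exists :: "(real \<Rightarrow> real) \<Rightarrow> (real \<Rightarrow> real) \<Rightarrow> real \<Rightarrow> bool" where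
  "convolution_exists f g x \<longleftrightarrow> integrable lborel (\<lambda>s. f s * g (x - s))"

definition convolution :: "(real \<Rightarrow> real) \<Rightarrow> (real \<Rightarrow> real) \<Rightarrow> real \<Rightarrow> real" where
  "convolution f g x = (LINT s|lborel. f s * g (x - s))"

definition optimal_siac_coeffs :: "nat \<Rightarrow> (int \<Rightarrow> real) \<Rightarrow> real vec \<Rightarrow> bool" where
  "optimal_siac_coeffs d t c \<longleftrightarrow>
     c \<in> carrier_vec (2 * d + 1) \<and>
     (\<forall>\<delta>\<le>2 * d. \<forall>x.
        convolution_exists (siac_kernel d t c) (\<lambda>s. s ^ \<delta>) x \<and>
        convolution (siac_kernel d t c) (\<lambda>s. s ^ \<delta>) x = x ^ \<delta>)"

text \<open>Row \<open>\<delta>\<close>, column \<open>\<gamma> + d\<close>.\<close>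

definition M0 :: "nat \<Rightarrow> (int \<Rightarrow> real) \<Rightarrow> real mat" where
  "M0 d t = mat (2 * d + 1) (2 * d + 1)
     (\<lambda>(\<delta>, k). divdiff t (int k - int d) (d + 1) (\<lambda>s. s ^ (d + 1 + \<delta>)))"

text \<open>\<open>M\<^sub>0\<^sup>-\<^sup>1 e\<^sub>1\<close>; meaningful if \<open>M\<^sub>0\<close> is invertible. The unit vector \<open>e\<^sub>1\<close> has index 0 here.\<close>

definition M0_inv_e1 :: "nat \<Rightarrow> (int \<Rightarrow> real) \<Rightarrow> real vec" where
  "M0_inv_e1 d t = the (mat_inverse (M0 d t)) *\<^sub>v unit_vec (2 * d + 1) 0"

text \<open>
  The splines of \<^const>\<open>bspline\<close> have integral \<open>(t\<^sub>j - t\<^sub>i) / (d + 1)\<close>, whereas \<open>M\<^sub>0\<close> contains the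
  moments of splines of integral 1. This vector has the entries
  \<open>(t\<^bsub>\<gamma>+d+1\<^esub> - t\<^sub>\<gamma>) / (d + 1) * c\<^sub>\<gamma>\<close>, i.e. the coefficients of the same kernel with
  respect to the splines of integral 1. It is \<open>c\<close> itself if all these supports have length \<open>d + 1\<close>.
\<close>

definition unit_integral_coeffs :: "nat \<Rightarrow> (int \<Rightarrow> real) \<Rightarrow> real vec \<Rightarrow> real vec" where
  "unit_integral_coeffs d t c = vec (2 * d + 1)
     (\<lambda>k. (t (int k + 1) - t (int k - int d)) / (real d + 1) * vec_index c k)"

end

theory Submission
  imports Defs "Jordan_Normal_Form.Determinant"
begin

text \<open>
  The binomial theorem turns the reproduction property into conditions on the moments of the kernel:
  the \<open>0\<close>th moment is 1 and the next \<open>2d\<close> moments vanish. By Peano's theorem the \<open>m\<close>th moment of the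
  B-spline on \<open>t\<^sub>\<gamma>, \<dots>, t\<^bsub>\<gamma>+d+1\<^esub>\<close> is a positive constant depending only on \<open>m\<close> and \<open>d\<close>, times
  \<open>t\<^bsub>\<gamma>+d+1\<^esub> - t\<^sub>\<gamma>\<close>, times the entry of \<open>M\<^sub>0\<close>, so the moment conditions are \<open>M\<^sub>0 u = e\<^sub>1\<close> for the rescaled
  coefficients \<open>u\<close>.

  A vector in the left kernel of \<open>M\<^sub>0\<close> is a polynomial \<open>p\<close> of degree at most \<open>3d + 1\<close>, divisible by
  \<open>s\<^bsup>d+1\<^esup>\<close>, all of whose divided differences of order \<open>d + 1\<close> vanish. If no knot is repeated more than
  \<open>d + 2\<close> times, the recursion makes all higher divided differences vanish, too. The one of order
  \<open>degree p\<close> is the leading coefficient of \<open>p\<close>, hence \<open>p = 0\<close>.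
\<close>

section \<open>Divided differences, mainly of polynomials\<close>

lemma higher_deriv_poly:
  fixes p :: "real poly"
  shows "(deriv ^^ n) (poly p) = poly ((pderiv ^^ n) p)"
  by (induction n) (auto intro!: ext DERIV_imp_deriv)

lemma higher_pderiv_pCons_0:
  fixes p :: "real poly"
  shows "(pderiv ^^ Suc n) (pCons 0 p) = pCons 0 ((pderiv ^^ Suc n) p) + Polynomial.smult (real (Suc n)) ((pderiv ^^ n) p)"
proof (induction n)
  case 0
  show ?case by (simp add: pderiv_pCons)
next
  case (Suc n)
  have "(pderiv ^^ Suc (Suc n)) (pCons 0 p) = pderiv ((pderiv ^^ Suc n) (pCons 0 p))"
    by simp
  also have "\<dots> = pderiv (pCons 0 ((pderiv ^^ Suc n) p) + Polynomial.smult (real (Suc n)) ((pderiv ^^ n) p))"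
    by (simp only: Suc)
  also have "\<dots> = pCons 0 ((pderiv ^^ Suc (Suc n)) p) + Polynomial.smult (real (Suc (Suc n))) ((pderiv ^^ Suc n) p)"
    using smult_add_left[of 1 "real (Suc n)" "(pderiv ^^ Suc n) p"]
    by (simp only: pderiv_add pderiv_pCons pderiv_smult funpow.simps o_apply of_nat_Suc[of "Suc n"])
      (simp only: smult_1_left ac_simps)
  finally show ?case .
qed

lemma mono_on_int_subinterval:
  fixes t :: "int \<Rightarrow> real"
  assumes "mono_on {l..u} t" "l \<le> l'" "u' \<le> u"
  shows "mono_on {l'..u'} t"
  using assms by (auto intro: mono_on_subset)

lemma divdiff_confluent:
  assumes "t i = t (i + int k)"
  shows "divdiff t i k h = (deriv ^^ k) h (t i) / fact k"
  using assms by (cases k) auto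

text \<open>The recursion without division, so as to cover coinciding end knots: monotonicity then
  makes all knots of the window equal, and both lower differences are the same derivative.\<close>

lemma divdiff_diff:
  assumes "mono_on {i..i + int (Suc k)} t"
  shows "divdiff t (i + 1) k h - divdiff t i k h = (t (i + int (Suc k)) - t i) * divdiff t i (Suc k) h"
proof (cases "t i = t (i + int (Suc k))")
  case True
  have le: "t x \<le> t y" if "i \<le> x" "x \<le> y" "y \<le> i + int (Suc k)" for x y
    using that by (intro mono_onD[OF assms]) auto
  have "t (i + 1) = t i" "t (i + int k) = t i" "t (i + 1 + int k) = t i"
    using le[of i "i + 1"] le[of "i + 1" "i + int (Suc k)"] le[of i "i + int k"]
      le[of "i + int k" "i + int (Suc k)"] True by (auto simp: algebra_simps)
  then show ?thesis
    using True divdiff_confluent[of t i k h] divdiff_confluent[of t "i + 1" k h] by simp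
qed simp

text \<open>Kept to polynomials, since at confluent knots \<open>deriv\<close> is additive only on
  differentiable functions.\<close>

lemma divdiff_poly_add:
  "divdiff t i k (poly (p + q)) = divdiff t i k (poly p) + divdiff t i k (poly q)"
proof (induction k arbitrary: i)
  case (Suc k)
  then show ?case
    unfolding divdiff.simps higher_deriv_poly higher_pderiv_add Suc
    unfolding poly_add
    by (simp add: add_divide_distrib diff_divide_distrib)
qed simp

lemma divdiff_poly_smult:
  "divdiff t i k (poly (Polynomial.smult c p)) = c * divdiff t i k (poly p)"
proof (induction k arbitrary: i)
  case (Suc k)
  then show ?case
    unfolding divdiff.simps higher_deriv_poly higher_pderiv_smult Suc
    unfolding poly_smult
    by (simp add: right_diff_distrib diff_divide_distrib)
qed simp

lemma divdiff_poly_0: "divdiff t i k (poly 0) = 0"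
  using divdiff_poly_smult[of t i k 0 0] by simp

lemma divdiff_poly_sum:
  "divdiff t i k (poly (\<Sum>j\<in>A. f j)) = (\<Sum>j\<in>A. divdiff t i k (poly (f j)))"
  by (induction A rule: infinite_finite_induct) (simp_all only: sum.infinite sum.empty sum.insert not_False_eq_True divdiff_poly_0 divdiff_poly_add)

text \<open>Leibniz rule for the factor \<open>s\<close>, whose own differences are 1 at order 1 and
  0 beyond.\<close>

lemma divdiff_pCons_0:
  assumes "mono_on {i..i + int (Suc k)} t"
  shows "divdiff t i (Suc k) (poly (pCons 0 p)) =
    t i * divdiff t i (Suc k) (poly p) + divdiff t (i + 1) k (poly p)"
  using assms
proof (induction k arbitrary: i)
  case 0
  have "deriv (\<lambda>x. x * poly p x) x = poly p x + x * poly (pderiv p) x" for x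
    by (intro DERIV_imp_deriv) (auto intro!: derivative_eq_intros)
  moreover have "deriv (poly p) x = poly (pderiv p) x" for x
    by (intro DERIV_imp_deriv poly_DERIV)
  ultimately show ?case
    by (auto simp: field_simps)
next
  case (Suc k)
  show ?case
  proof (cases "t i = t (i + int (Suc (Suc k)))")
    case True
    have le: "t x \<le> t y" if "i \<le> x" "x \<le> y" "y \<le> i + int (Suc (Suc k))" for x y
      using that by (intro mono_onD[OF Suc.prems]) auto
    have eq: "t (i + 1) = t i"
      using le[of i "i + 1"] le[of "i + 1" "i + int (Suc (Suc k))"] True by auto
    then have eq': "t (i + 1) = t (i + 1 + int (Suc k))"
      using True by (simp add: algebra_simps)
    define A B where "A = poly ((pderiv ^^ Suc k) p) (t i)" and "B = poly ((pderiv ^^ Suc (Suc k)) p) (t i)"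
    have dA: "divdiff t (i + 1) (Suc k) (poly p) = A / fact (Suc k)"
      using divdiff_confluent[OF eq'] eq
      by (simp only: higher_deriv_poly A_def)
    have dB: "divdiff t i (Suc (Suc k)) (poly p) = B / fact (Suc (Suc k))"
      using divdiff_confluent[OF True] by (simp only: higher_deriv_poly B_def)
    have "divdiff t i (Suc (Suc k)) (poly (pCons 0 p)) =
        (t i * B + real (Suc (Suc k)) * A) / fact (Suc (Suc k))"
      unfolding divdiff_confluent[OF True] higher_deriv_poly higher_pderiv_pCons_0 A_def B_def
      by (simp only: poly_add poly_pCons poly_smult add_0_left)
    also have "\<dots> = t i * (B / fact (Suc (Suc k))) + A / fact (Suc k)"
      unfolding add_divide_distrib fact_Suc[of "Suc k"] by (simp del: of_nat_Suc fact_Suc)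
    finally show ?thesis unfolding dA dB .
  next
    case False
    let ?P = "pCons 0 p" and ?T = "t (i + int (Suc (Suc k)))"
    have m1: "mono_on {i + 1..i + 1 + int (Suc k)} t" and m0: "mono_on {i..i + int (Suc k)} t"
      using Suc.prems by (rule mono_on_int_subinterval; simp)+
    let ?a = "divdiff t (i + 1) (Suc k) (poly p)" and ?b = "divdiff t i (Suc k) (poly p)"
    have rec: "divdiff t i (Suc (Suc k)) h = (divdiff t (i + 1) (Suc k) h - divdiff t i (Suc k) h) / (?T - t i)" for h
      using False by (simp only: divdiff.simps if_False)
    have "divdiff t (i + 1) (Suc k) (poly ?P) - divdiff t i (Suc k) (poly ?P)
       = t (i + 1) * ?a - t i * ?b + (divdiff t (i + 1 + 1) k (poly p) - divdiff t (i + 1) k (poly p))"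
      using Suc.IH[OF m1] Suc.IH[OF m0] by (simp del: divdiff.simps poly_pCons)
    \<comment> \<open>The inner knots may coincide although the end knots differ, hence the
      division-free recursion.\<close>
    also have "divdiff t (i + 1 + 1) k (poly p) - divdiff t (i + 1) k (poly p) = (?T - t (i + 1)) * ?a"
      using divdiff_diff[OF m1] by (simp add: algebra_simps del: divdiff.simps)
    also have "t (i + 1) * ?a - t i * ?b + (?T - t (i + 1)) * ?a = (?T - t i) * ?a + t i * (?a - ?b)"
      by (simp add: algebra_simps)
    finally show ?thesis
      using False unfolding rec by (simp add: add_divide_distrib del: divdiff.simps poly_pCons)
  qed
qed

text \<open>Each factor \<open>s\<close> lowers degree and order together; the other Leibniz term
  vanishes because its degree lies below its order.\<close>

lemma divdiff_monom:
  assumes "mono_on {i..i + int k} t" "m \<le> k"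
  shows "divdiff t i k (poly (Polynomial.monom 1 m)) = (if m = k then 1 else 0)"
  using assms
proof (induction m arbitrary: i k)
  case 0
  show ?case
  proof (cases k)
    case (Suc j)
    have z: "divdiff t i (Suc j) (poly 1) = 0" for i
    proof (induction j arbitrary: i)
      case 0 show ?case by (simp add: higher_deriv_poly[of 1, simplified])
    next
      case (Suc j)
      have "(pderiv ^^ Suc (Suc j)) (1::real poly) = 0"
        using higher_pderiv_monom_eq_zero[of 0 "Suc (Suc j)" "1::real"] by (simp del: funpow.simps add: monom_0 one_pCons)
      then show ?case unfolding divdiff.simps(2)[of t i "Suc j"] Suc higher_deriv_poly by simp
    qed
    then show ?thesis using Suc by (simp only: monom_0 one_pCons[symmetric]) simp
  qed (simp add: poly_monom)
next
  case (Suc m)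
  then obtain j where k: "k = Suc j" by (cases k) auto
  have "mono_on {i + 1..i + 1 + int j} t"
    using Suc.prems(1) k by (intro mono_on_int_subinterval[OF Suc.prems(1)]) auto
  then show ?case
    using Suc k divdiff_pCons_0[of i j t "Polynomial.monom 1 m"] by (simp only: monom_Suc) auto
qed

lemma divdiff_degree_le:
  assumes "mono_on {i..i + int k} t" "Polynomial.degree p \<le> k"
  shows "divdiff t i k (poly p) = Polynomial.coeff p k"
proof -
  have "p = (\<Sum>j\<le>k. Polynomial.smult (Polynomial.coeff p j) (Polynomial.monom 1 j))"
    using poly_as_sum_of_monoms'[OF assms(2)] by (simp add: smult_monom)
  then have "divdiff t i k (poly p) =
      divdiff t i k (poly (\<Sum>j\<le>k. Polynomial.smult (Polynomial.coeff p j) (Polynomial.monom 1 j)))" by simp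
  also have "\<dots> = (\<Sum>j\<le>k. Polynomial.coeff p j * (if j = k then 1 else 0))"
    unfolding divdiff_poly_sum divdiff_poly_smult
    by (intro sum.cong refl) (simp add: divdiff_monom[OF assms(1)])
  finally show ?thesis by (simp add: if_distrib[of "\<lambda>y. _ * y"] cong: if_cong)
qed

text \<open>Only coefficients below \<open>k\<close> survive the hypothesis. This allows a
  polynomial to be exchanged for another one with the same \<open>k\<close>th derivative.\<close>

lemma divdiff_higher_pderiv_eq_0:
  assumes "mono_on {i..i + int k} t" "(pderiv ^^ k) p = 0"
  shows "divdiff t i k (poly p) = 0"
proof -
  have c: "Polynomial.coeff p j = 0" if "k \<le> j" for j
  proof -
    have "pochhammer (of_nat (Suc (j - k))) k * Polynomial.coeff p j = 0"
      using coeff_higher_pderiv[of k p "j - k"] assms(2) that by simp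
    then show ?thesis by (simp add: pochhammer_eq_0_iff)
  qed
  then have "Polynomial.degree p \<le> k" by (intro degree_le) auto
  then show ?thesis using divdiff_degree_le[OF assms(1)] c by simp
qed

lemma degree_less_if_divdiffs_vanish:
  assumes mono: "mono_on {l..l + int n} t"
    and deg: "Polynomial.degree p \<le> n"
    and mult: "\<And>i. l \<le> i \<Longrightarrow> i + int k < l + int n \<Longrightarrow> t i < t (i + int k + 1)"
    and zero: "\<And>i. l \<le> i \<Longrightarrow> i + int k \<le> l + int n \<Longrightarrow> divdiff t i k (poly p) = 0"
  shows "p = 0 \<or> Polynomial.degree p < k"
proof (rule ccontr)
  assume "\<not> (p = 0 \<or> Polynomial.degree p < k)"
  then have p: "p \<noteq> 0" "k \<le> Polynomial.degree p" by auto
  have vanish: "divdiff t i (k + m) (poly p) = 0" if "l \<le> i" "i + int (k + m) \<le> l + int n" for i m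
    using that
  proof (induction m arbitrary: i)
    case (Suc m)
    \<comment> \<open>Distinct end knots select the quotient branch, so vanishing passes up from the
      two shorter windows.\<close>
    have "t i < t (i + int k + 1)" using Suc.prems by (intro mult) auto
    also have "\<dots> \<le> t (i + int (Suc (k + m)))"
      using Suc.prems by (intro mono_onD[OF mono]) auto
    finally show ?case using Suc.IH[of i] Suc.IH[of "i + 1"] Suc.prems by simp
  qed (use zero in auto)
  have "divdiff t l (k + (Polynomial.degree p - k)) (poly p) = 0"
    using p deg by (intro vanish) auto
  then have "divdiff t l (Polynomial.degree p) (poly p) = 0" using p by simp
  moreover have "divdiff t l (Polynomial.degree p) (poly p) = Polynomial.coeff p (Polynomial.degree p)"
    using deg by (intro divdiff_degree_le mono_on_int_subinterval[OF mono]) auto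
  ultimately show False using p(1) by simp
qed

text \<open>Confluent knots involve derivatives; agreement on an open set passes to all of them,
  agreement at the knots alone does not.\<close>

lemma divdiff_cong_open:
  assumes "open S" "\<And>s. s \<in> S \<Longrightarrow> h s = h' s" "\<And>j. i \<le> j \<Longrightarrow> j \<le> i + int k \<Longrightarrow> t j \<in> S"
  shows "divdiff t i k h = divdiff t i k h'"
proof -
  have D: "(deriv ^^ n) h s = (deriv ^^ n) h' s" if "s \<in> S" for n s
    using that
  proof (induction n arbitrary: s)
    case (Suc n)
    have "\<forall>\<^sub>F x in nhds s. (deriv ^^ n) h x = (deriv ^^ n) h' x"
      using eventually_nhds_in_open[OF assms(1) Suc.prems] by eventually_elim (rule Suc.IH)
    then show ?case by (auto intro: deriv_cong_ev)
  qed (use assms(2) in auto)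
  show ?thesis
    using assms(3)
  proof (induction k arbitrary: i)
    case 0
    then show ?case using assms(2) by simp
  next
    case (Suc k)
    then have "divdiff t i k h = divdiff t i k h'" "divdiff t (i + 1) k h = divdiff t (i + 1) k h'"
      and "(deriv ^^ Suc k) h (t i) = (deriv ^^ Suc k) h' (t i)"
      by (auto intro!: D simp del: funpow.simps)
    then show ?case by (auto simp del: funpow.simps)
  qed
qed

section \<open>Taylor remainders and Peano kernels\<close>

lemma pderiv_surj:
  fixes q :: "real poly"
  shows "\<exists>p. pderiv p = q"
proof
  have "pderiv (\<Sum>i\<le>Polynomial.degree q. Polynomial.monom (Polynomial.coeff q i / real (Suc i)) (Suc i)) =
      (\<Sum>i\<le>Polynomial.degree q. Polynomial.monom (Polynomial.coeff q i) i)"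
    by (simp add: higher_pderiv_sum[of 1, simplified] pderiv_monom del: of_nat_Suc)
  then show "pderiv (\<Sum>i\<le>Polynomial.degree q. Polynomial.monom (Polynomial.coeff q i / real (Suc i)) (Suc i)) = q"
    by (simp only: poly_as_sum_of_monoms)
qed

text \<open>Iterated integration from \<open>a\<close>; it supplies polynomials without boundary
  terms at \<open>a\<close>.\<close>

lemma higher_antiderivative:
  fixes q :: "real poly"
  shows "\<exists>g. (pderiv ^^ n) g = q \<and> (\<forall>j<n. poly ((pderiv ^^ j) g) a = 0)"
proof (induction n arbitrary: q)
  case (Suc n)
  obtain p where p: "pderiv p = q" using pderiv_surj by blast
  \<comment> \<open>Subtracting the constant makes the derivative of order \<open>n\<close> vanish
    at \<open>a\<close>, too.\<close>
  obtain g where g: "(pderiv ^^ n) g = p - [:poly p a:]" "\<forall>j<n. poly ((pderiv ^^ j) g) a = 0"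
    using Suc by blast
  have "(pderiv ^^ Suc n) g = q"
    by (simp add: g(1) pderiv_diff p pderiv_pCons)
  moreover have "poly ((pderiv ^^ j) g) a = 0" if "j < Suc n" for j
    using g that by (cases "j = n") auto
  ultimately show ?case by blast
qed simp

text \<open>Taylor's formula with integral remainder; the assumption removes the Taylor polynomial
  at \<open>a\<close>.\<close>

lemma integral_taylor_remainder:
  fixes g :: "real poly"
  assumes "a \<le> b" "\<And>j. j \<le> e \<Longrightarrow> poly ((pderiv ^^ j) g) a = 0"
  shows "has_bochner_integral lborel
    (\<lambda>x. (b - x) ^ e * poly ((pderiv ^^ Suc e) g) x * indicator {a..b} x) (fact e * poly g b)"
proof -
  \<comment> \<open>The Taylor polynomial of \<open>g\<close> at \<open>x\<close>, evaluated at \<open>b\<close>: its \<open>x\<close>-derivative telescopes.\<close>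
  define T where "T x = (\<Sum>j\<le>e. poly ((pderiv ^^ j) g) x * (b - x) ^ j / fact j)" for x
  have T': "(T has_real_derivative (b - x) ^ e / fact e * poly ((pderiv ^^ Suc e) g) x) (at x)" for x
    unfolding T_def
  proof (induction e)
    case 0
    show ?case by (auto intro!: derivative_eq_intros)
  next
    case (Suc e)
    have "((\<lambda>x. poly ((pderiv ^^ Suc e) g) x * (b - x) ^ Suc e) has_real_derivative
       poly ((pderiv ^^ Suc (Suc e)) g) x * (b - x) ^ Suc e - poly ((pderiv ^^ Suc e) g) x * (real (Suc e) * (b - x) ^ e)) (at x)"
      by (auto intro!: derivative_eq_intros simp: algebra_simps simp del: of_nat_Suc power_Suc)
    from DERIV_add[OF Suc DERIV_cdivide[OF this, of "fact (Suc e)"]]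
    have "((\<lambda>x. \<Sum>j\<le>Suc e. poly ((pderiv ^^ j) g) x * (b - x) ^ j / fact j) has_real_derivative
        (b - x) ^ e / fact e * poly ((pderiv ^^ Suc e) g) x +
        (poly ((pderiv ^^ Suc (Suc e)) g) x * (b - x) ^ Suc e
          - poly ((pderiv ^^ Suc e) g) x * (real (Suc e) * (b - x) ^ e)) / fact (Suc e)) (at x)"
      by (simp only: sum.atMost_Suc)
    also have "(b - x) ^ e / fact e * poly ((pderiv ^^ Suc e) g) x +
        (poly ((pderiv ^^ Suc (Suc e)) g) x * (b - x) ^ Suc e
          - poly ((pderiv ^^ Suc e) g) x * (real (Suc e) * (b - x) ^ e)) / fact (Suc e)
        = (b - x) ^ Suc e / fact (Suc e) * poly ((pderiv ^^ Suc (Suc e)) g) x"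
      by (simp add: diff_divide_distrib del: funpow.simps of_nat_Suc power_Suc)
    finally show ?case .
  qed
  have "((\<lambda>x. fact e * T x) has_real_derivative (b - x) ^ e * poly ((pderiv ^^ Suc e) g) x) (at x)" for x
    using DERIV_cmult[OF T', of "fact e" x] by (simp add: mult.assoc)
  then have "has_bochner_integral lborel
    (\<lambda>x. (b - x) ^ e * poly ((pderiv ^^ Suc e) g) x * indicator {a..b} x) (fact e * T b - fact e * T a)"
    by (intro has_bochner_integral_FTC_Icc_real assms(1)) (auto intro!: continuous_intros)
  moreover have "T a = 0" using assms(2) by (simp add: T_def)
  moreover have "T b = poly g b"
    by (auto simp: T_def power_0_left if_distrib[of "\<lambda>y. y / _"] if_distrib[of "\<lambda>y. _ * y"] cong: if_cong)
  ultimately show ?thesis by simp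
qed

lemma integral_trunc_pow:
  fixes g :: "real poly"
  assumes "a \<le> b" "\<And>j. j \<le> e \<Longrightarrow> poly ((pderiv ^^ j) g) a = 0"
  shows "has_bochner_integral lborel
    (\<lambda>x. indicator {a..} x * trunc_pow e (b - x) * poly ((pderiv ^^ Suc e) g) x) (fact e * poly g b)"
  using integral_taylor_remainder[OF assms]
  \<comment> \<open>The integrands differ at most at \<open>x = b\<close>, and only for
    \<open>e = 0\<close>, where \<open>trunc_pow 0 0 = 0\<close> but
    \<open>0 ^ 0 = 1\<close>.\<close>
  by (rule has_bochner_integral_discrete_difference[where X = "{b}", THEN iffD1, rotated 4])
    (auto simp: trunc_pow_def indicator_def)

lemma higher_deriv_trunc_pow:
  assumes "k \<le> d" "s \<noteq> x"
  shows "(deriv ^^ k) (\<lambda>s. trunc_pow d (s - x)) s = fact d / fact (d - k) * trunc_pow (d - k) (s - x)"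
  using assms
proof (induction k arbitrary: s)
  case (Suc k)
  define e where "e = d - Suc k"
  have e: "d - k = Suc e" using Suc.prems by (simp add: e_def)
  have "((\<lambda>s. fact d / fact (Suc e) * trunc_pow (Suc e) (s - x)) has_real_derivative
      fact d / fact e * trunc_pow e (s - x)) (at s)"
  proof (cases "x < s")
    case True
    have "((\<lambda>s. fact d / fact (Suc e) * (s - x) ^ Suc e) has_real_derivative
      fact d / fact (Suc e) * (real (Suc e) * (s - x) ^ e)) (at s)"
      by (auto intro!: derivative_eq_intros simp del: of_nat_Suc fact_Suc power_Suc)
    also have "fact d / fact (Suc e) * (real (Suc e) * (s - x) ^ e) = fact d / fact e * trunc_pow e (s - x)"
      using True by (simp add: trunc_pow_def del: of_nat_Suc)
    finally show ?thesis
      by (rule has_field_derivative_transform_within_open[of _ _ _ "{x<..}"]) (use True in \<open>auto simp: trunc_pow_def\<close>)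
  next
    case False
    have "((\<lambda>s. 0) has_real_derivative fact d / fact e * trunc_pow e (s - x)) (at s)"
      using False by (simp add: trunc_pow_def)
    then show ?thesis
      by (rule has_field_derivative_transform_within_open[of _ _ _ "{..<x}"]) (use False Suc.prems in \<open>auto simp: trunc_pow_def\<close>)
  qed
  then have "deriv (\<lambda>s. fact d / fact (Suc e) * trunc_pow (Suc e) (s - x)) s = fact d / fact e * trunc_pow e (s - x)"
    by (rule DERIV_imp_deriv)
  \<comment> \<open>The points other than \<open>x\<close> form an open set, so the induction
    hypothesis holds near \<open>s\<close> and can be differentiated.\<close>
  moreover have "\<forall>\<^sub>F y in nhds s. (deriv ^^ k) (\<lambda>s. trunc_pow d (s - x)) y = fact d / fact (Suc e) * trunc_pow (Suc e) (y - x)"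
    using t1_space_nhds[OF Suc.prems(2)]
    by (rule eventually_mono) (use Suc.prems in \<open>simp add: Suc.IH e del: fact_Suc\<close>)
  ultimately show ?case
    by (simp add: deriv_cong_ev e_def)
qed simp

text \<open>
  Below order \<open>d + 1\<close> the divided differences of the truncated power do not have compact support,
  hence the restriction to a half-line, on which \<open>g\<close> absorbs the boundary terms.
\<close>

lemma peano_kernel_half_line:
  fixes g :: "real poly"
  assumes mono: "mono_on {i..i + int k} t" and a: "a \<le> t i"
    and g: "\<And>j. j \<le> d \<Longrightarrow> poly ((pderiv ^^ j) g) a = 0"
    and k: "k \<le> d \<or> k = Suc d \<and> t i < t (i + int k)"
  shows "has_bochner_integral lborel
    (\<lambda>x. indicator {a..} x * divdiff t i k (\<lambda>s. trunc_pow d (s - x)) * poly ((pderiv ^^ Suc d) g) x)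
    (fact d * divdiff t i k (poly g))"
  using mono a k
proof (induction k arbitrary: i)
  case 0
  then show ?case using integral_trunc_pow[of a "t i" d g] g by (simp del: funpow.simps)
next
  case (Suc k)
  show ?case
  proof (cases "t i = t (i + int (Suc k))")
    case True
    then have kd: "Suc k \<le> d" using Suc.prems by auto
    define e where "e = d - Suc k"
    have pp: "(pderiv ^^ j) ((pderiv ^^ Suc k) g) = (pderiv ^^ (j + Suc k)) g" for j
      by (simp only: funpow_add o_apply)
    \<comment> \<open>Taylor remainder for the derivative of \<open>g\<close> of order
      \<open>k + 1\<close>: a further \<open>e + 1\<close> derivatives give order
      \<open>d + 1\<close>.\<close>
    have "has_bochner_integral lborel
      (\<lambda>x. indicator {a..} x * trunc_pow e (t i - x) * poly ((pderiv ^^ Suc e) ((pderiv ^^ Suc k) g)) x)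
      (fact e * poly ((pderiv ^^ Suc k) g) (t i))"
    proof (intro integral_trunc_pow Suc.prems(2))
      fix j assume "j \<le> e"
      then show "poly ((pderiv ^^ j) ((pderiv ^^ Suc k) g)) a = 0"
        unfolding pp using kd by (intro g) (simp add: e_def)
    qed
    then have "has_bochner_integral lborel
      (\<lambda>x. indicator {a..} x * trunc_pow e (t i - x) * poly ((pderiv ^^ Suc d) g) x)
      (fact e * poly ((pderiv ^^ Suc k) g) (t i))"
      unfolding pp using kd by (simp add: e_def del: funpow.simps)
    from has_bochner_integral_mult_right[OF this, of "fact d / fact e / fact (Suc k)"]
    have "has_bochner_integral lborel
      (\<lambda>x. fact d / fact e / fact (Suc k) * (indicator {a..} x * trunc_pow e (t i - x) * poly ((pderiv ^^ Suc d) g) x))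
      (fact d * divdiff t i (Suc k) (poly g))"
      using divdiff_confluent[OF True, of "poly g"] by (simp add: higher_deriv_poly del: funpow.simps divdiff.simps fact_Suc)
    then show ?thesis
      \<comment> \<open>At \<open>x = t i\<close> the derivative of the truncated power may not
        exist; one point does not affect the integral.\<close>
      by (rule has_bochner_integral_discrete_difference[where X = "{t i}", THEN iffD1, rotated 4])
        (simp_all add: divdiff_confluent[OF True] higher_deriv_trunc_pow[OF kd] e_def del: funpow.simps divdiff.simps fact_Suc)
  next
    case False
    have m1: "mono_on {i + 1..i + 1 + int k} t" and m0: "mono_on {i..i + int k} t"
      using Suc.prems(1) by (rule mono_on_int_subinterval; simp)+
    have "t i \<le> t (i + 1)" by (rule mono_onD[OF Suc.prems(1)]) auto
    then have a1: "a \<le> t (i + 1)" using Suc.prems(2) by simp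
    have kd: "k \<le> d \<or> k = Suc d \<and> P" for P using Suc.prems(3) by auto
    note I = has_bochner_integral_divide_zero[OF
      has_bochner_integral_diff[OF Suc.IH[OF m1 a1 kd] Suc.IH[OF m0 Suc.prems(2) kd]],
      of "t (i + int (Suc k)) - t i"]
    show ?thesis
      using I False by (simp add: algebra_simps diff_divide_distrib del: funpow.simps)
  qed
qed

section \<open>Moments of B-splines\<close>

text \<open>The half-line formula with \<open>a = t i\<close> extends to the whole line because the
  B-spline vanishes left of \<open>t i\<close>; \<open>f\<close> is first exchanged for a polynomial
  without boundary terms there.\<close>

lemma has_bochner_integral_bspline:
  fixes f :: "real poly"
  assumes mono: "mono_on {i..i + int (Suc d)} t"
  shows "has_bochner_integral lborel (\<lambda>x. bspline d t i (i + int d + 1) x * poly ((pderiv ^^ Suc d) f) x)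
    ((t (i + int d + 1) - t i) * (fact d * divdiff t i (Suc d) (poly f)))"
proof (cases "t i = t (i + int (Suc d))")
  case True
  \<comment> \<open>The factor in front is 0 on both sides, whatever value the divided difference
    takes.\<close>
  then show ?thesis by (simp add: bspline_def algebra_simps has_bochner_integral_zero)
next
  case False
  have le: "t i \<le> t j" if "i \<le> j" "j \<le> i + int (Suc d)" for j
    using that by (intro mono_onD[OF mono]) auto
  have lt: "t i < t (i + int (Suc d))" using le[of "i + int (Suc d)"] False by simp
  obtain g where g: "(pderiv ^^ Suc d) g = (pderiv ^^ Suc d) f" "\<And>j. j < Suc d \<Longrightarrow> poly ((pderiv ^^ j) g) (t i) = 0"
    using higher_antiderivative by blast
  have "(pderiv ^^ Suc d) (f + Polynomial.smult (-1) g) = 0"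
    using g(1) by (simp only: higher_pderiv_add higher_pderiv_smult) simp
  then have "divdiff t i (Suc d) (poly (f + Polynomial.smult (-1) g)) = 0"
    by (rule divdiff_higher_pderiv_eq_0[OF mono])
  then have dd: "divdiff t i (Suc d) (poly g) = divdiff t i (Suc d) (poly f)"
    by (simp only: divdiff_poly_add divdiff_poly_smult)
  let ?F = "\<lambda>x. divdiff t i (Suc d) (\<lambda>s. trunc_pow d (s - x))"
  \<comment> \<open>Near the knots, all right of \<open>x\<close>, the truncated power is a
    polynomial of degree \<open>d\<close>, which order \<open>d + 1\<close> annihilates.\<close>
  have supp: "?F x = 0" if "x < t i" for x
  proof -
    have deg: "Polynomial.degree ([:- x, 1:] ^ d) = d" by (simp add: degree_linear_power)
    have "?F x = divdiff t i (Suc d) (poly ([:- x, 1:] ^ d))"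
      using that by (intro divdiff_cong_open[of "{x<..}"])
        (auto simp: trunc_pow_def poly_power intro: less_le_trans[OF _ le])
    also have "\<dots> = 0"
      using divdiff_degree_le[OF mono, of "[:- x, 1:] ^ d"] deg by (simp add: coeff_eq_0)
    finally show ?thesis .
  qed
  have "has_bochner_integral lborel
    (\<lambda>x. indicator {t i..} x * ?F x * poly ((pderiv ^^ Suc d) g) x)
    (fact d * divdiff t i (Suc d) (poly g))"
    using lt g(2) by (intro peano_kernel_half_line[OF mono]) auto
  also have "(\<lambda>x. indicator {t i..} x * ?F x * poly ((pderiv ^^ Suc d) g) x) = (\<lambda>x. ?F x * poly ((pderiv ^^ Suc d) f) x)"
    using supp g(1) by (intro ext) (auto simp: indicator_def simp del: funpow.simps divdiff.simps)
  finally have "has_bochner_integral lborel (\<lambda>x. (t (i + int d + 1) - t i) * (?F x * poly ((pderiv ^^ Suc d) f) x))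
      ((t (i + int d + 1) - t i) * (fact d * divdiff t i (Suc d) (poly f)))"
    unfolding dd by (rule has_bochner_integral_mult_right)
  moreover have "nat (i + int d + 1 - i) = Suc d" by simp
  ultimately show ?thesis unfolding bspline_def by (simp only: mult.assoc)
qed

text \<open>The constant \<open>(m + 1) * ... * (m + d + 1)\<close> comes from differentiating the
  monomial of degree \<open>d + 1 + m\<close> exactly \<open>d + 1\<close> times.\<close>

lemma bspline_moment:
  assumes mono: "mono_on {i..i + int (Suc d)} t"
  shows "has_bochner_integral lborel (\<lambda>x. bspline d t i (i + int d + 1) x * x ^ m)
    ((t (i + int d + 1) - t i) * fact d / pochhammer (real (Suc m)) (Suc d) *
      divdiff t i (Suc d) (\<lambda>s. s ^ (Suc d + m)))"
proof -
  let ?C = "pochhammer (real (Suc m)) (Suc d)" and ?f = "Polynomial.monom (1::real) (Suc d + m)"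
  have C: "?C \<noteq> 0" by (simp add: pochhammer_eq_0_iff)
  have "(pderiv ^^ Suc d) ?f = Polynomial.monom ?C m"
    by (rule poly_eqI) (auto simp: coeff_higher_pderiv simp del: funpow.simps)
  then have "poly ((pderiv ^^ Suc d) ?f) x = ?C * x ^ m" for x
    by (simp only: poly_monom)
  then have "has_bochner_integral lborel (\<lambda>x. bspline d t i (i + int d + 1) x * (?C * x ^ m))
      ((t (i + int d + 1) - t i) * (fact d * divdiff t i (Suc d) (poly ?f)))"
    using has_bochner_integral_bspline[OF mono, of ?f] by (simp only:)
  from has_bochner_integral_divide_zero[OF this, of ?C] C
  have "has_bochner_integral lborel (\<lambda>x. bspline d t i (i + int d + 1) x * x ^ m)
      ((t (i + int d + 1) - t i) * (fact d * divdiff t i (Suc d) (poly ?f)) / ?C)"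
    by (simp add: mult.left_commute del: pochhammer_Suc)
  moreover have "poly ?f = (\<lambda>s. s ^ (Suc d + m))" by (intro ext) (simp only: poly_monom mult_1_left)
  ultimately show ?thesis by (simp only: times_divide_eq_left times_divide_eq_right mult.assoc)
qed

section \<open>Inverse matrices\<close>

lemma invertible_mat_if_det_nonzero:
  fixes A :: "'a :: field mat"
  assumes A: "A \<in> carrier_mat n n" and "Determinant.det A \<noteq> 0"
  shows "invertible_mat A"
proof -
  have "A \<in> Units (ring_mat TYPE('a) n ())"
    using det_non_zero_imp_unit[OF A assms(2)] .
  then obtain B where "B \<in> carrier_mat n n" "A * B = 1\<^sub>m n" "B * A = 1\<^sub>m n"
    by (auto simp: Units_def ring_mat_def)
  then show ?thesis
    using A by (auto simp: invertible_mat_def inverts_mat_def)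
qed

lemma the_mat_inverse:
  fixes A :: "'a :: field mat"
  assumes inv: "invertible_mat A" and A: "A \<in> carrier_mat n n"
  shows "A * the (mat_inverse A) = 1\<^sub>m n" "the (mat_inverse A) * A = 1\<^sub>m n"
    "the (mat_inverse A) \<in> carrier_mat n n"
proof -
  obtain B where AB: "A * B = 1\<^sub>m n" and BA: "B * A = 1\<^sub>m (dim_row B)"
    using inv A by (auto simp: invertible_mat_def inverts_mat_def)
  \<comment> \<open>\<open>invertible_mat\<close> does not fix the shape of \<open>B\<close>; the
    two products determine it.\<close>
  have "dim_col B = n" "dim_row B = n"
    using arg_cong[OF AB, of dim_col] arg_cong[OF BA, of dim_col] A by auto
  then have "B \<in> carrier_mat n n" "B * A = 1\<^sub>m n" using BA by auto
  then have "A \<in> Units (ring_mat TYPE('a) n ())"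
    using A AB by (auto simp: Units_def ring_mat_def)
  \<comment> \<open>\<open>mat_inverse\<close> yields \<open>None\<close> only for non-units, so
    \<open>the\<close> meets a \<open>Some\<close>.\<close>
  then obtain C where "mat_inverse A = Some C"
    using mat_inverse(1)[OF A, where b = "()"] by (cases "mat_inverse A") auto
  then show "A * the (mat_inverse A) = 1\<^sub>m n" "the (mat_inverse A) * A = 1\<^sub>m n"
    "the (mat_inverse A) \<in> carrier_mat n n"
    using mat_inverse(2)[OF A] by auto
qed

lemma mult_mat_vec_eq_iff_mat_inverse:
  fixes A :: "'a :: field mat"
  assumes inv: "invertible_mat A" and A: "A \<in> carrier_mat n n"
    and u: "u \<in> carrier_vec n" and b: "b \<in> carrier_vec n"
  shows "A *\<^sub>v u = b \<longleftrightarrow> u = the (mat_inverse A) *\<^sub>v b"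
proof -
  note C = the_mat_inverse[OF inv A]
  have "the (mat_inverse A) *\<^sub>v (A *\<^sub>v u) = u" "A *\<^sub>v (the (mat_inverse A) *\<^sub>v b) = b"
    using assoc_mult_mat_vec[OF C(3) A u] assoc_mult_mat_vec[OF A C(3) b] C u b by auto
  then show ?thesis by auto
qed

section \<open>Invertibility of \<open>M0\<close>\<close>

lemma M0_carrier: "M0 d t \<in> carrier_mat (2 * d + 1) (2 * d + 1)"
  by (simp add: M0_def)

lemma unit_integral_coeffs_carrier: "unit_integral_coeffs d t c \<in> carrier_vec (2 * d + 1)"
  by (simp add: unit_integral_coeffs_def)

text \<open>The windows in \<open>mult\<close> are all those of \<open>d + 3\<close> consecutive
  knots, so no knot value occurs more than \<open>d + 2\<close> times.\<close>

lemma invertible_M0: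
  assumes mono: "mono_on {- int d..2 * int d + 1} t"
    and mult: "\<And>i. - int d \<le> i \<Longrightarrow> i < int d \<Longrightarrow> t i < t (i + int d + 2)"
  shows "invertible_mat (M0 d t)"
proof (rule invertible_mat_if_det_nonzero[OF M0_carrier], rule notI)
  assume "Determinant.det (M0 d t) = 0"
  then have "Determinant.det (transpose_mat (M0 d t)) = 0"
    by (simp add: det_transpose[OF M0_carrier])
  then obtain v where v: "v \<in> carrier_vec (2 * d + 1)" "v \<noteq> 0\<^sub>v (2 * d + 1)"
    and Mv: "transpose_mat (M0 d t) *\<^sub>v v = 0\<^sub>v (2 * d + 1)"
    using det_0_iff_vec_prod_zero[OF transpose_carrier_mat[THEN iffD2, OF M0_carrier]] by blast
  \<comment> \<open>Row \<open>m\<close> belongs to \<open>s ^ (d + 1 + m)\<close>, so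
    \<open>v\<close> lists the coefficients from degree \<open>d + 1\<close> on, and its product
    with a column is a divided difference of \<open>p\<close>.\<close>
  define p where "p = (\<Sum>m<2 * d + 1. Polynomial.smult (v $ m) (Polynomial.monom 1 (d + 1 + m)))"
  have coeff: "Polynomial.coeff p (d + 1 + m) = v $ m" if "m < 2 * d + 1" for m
    using that by (simp add: p_def Polynomial.coeff_sum if_distrib[of "\<lambda>y. _ * y"] cong: if_cong)
  have deg: "Polynomial.degree p \<le> 3 * d + 1"
    unfolding p_def by (intro degree_sum_le) (auto intro!: order_trans[OF degree_smult_le] order_trans[OF degree_monom_le])
  have zero: "divdiff t i (Suc d) (poly p) = 0" if i: "- int d \<le> i" "i \<le> int d" for i
  proof -
    define k where "k = nat (i + int d)"
    have k: "k < 2 * d + 1" "i = int k - int d" using i by (auto simp: k_def)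
    have m: "poly (Polynomial.monom (1::real) n) = (\<lambda>s. s ^ n)" for n :: nat
      by (intro ext) (simp add: poly_monom)
    have "divdiff t i (Suc d) (poly p) = (\<Sum>m<2 * d + 1. v $ m * M0 d t $$ (m, k))"
      unfolding p_def divdiff_poly_sum divdiff_poly_smult m
      using k by (intro sum.cong) (simp_all add: M0_def)
    also have "\<dots> = (transpose_mat (M0 d t) *\<^sub>v v) $ k"
      using k v M0_carrier[of d t]
      by (auto simp: scalar_prod_def atLeast0LessThan mult.commute intro!: sum.cong)
    finally show ?thesis using Mv k by simp
  qed
  have "p = 0 \<or> Polynomial.degree p < Suc d"
  \<comment> \<open>The \<open>3 * d + 2\<close> knots reach order \<open>3 * d + 1\<close>, exactly
    the degree bound of \<open>p\<close>.\<close>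
  proof (rule degree_less_if_divdiffs_vanish[where t = t and l = "- int d" and n = "3 * d + 1"])
    fix i assume "- int d \<le> i" "i + int (Suc d) < - int d + int (3 * d + 1)"
    then show "t i < t (i + int (Suc d) + 1)" using mult[of i] by (simp add: algebra_simps)
  qed (use mono deg zero in auto)
  then have "Polynomial.coeff p (d + 1 + m) = 0" for m
    by (auto intro: coeff_eq_0)
  then have "v = 0\<^sub>v (2 * d + 1)"
    using v(1) coeff by (intro eq_vecI) auto
  then show False using v(2) by simp
qed

section \<open>Moments of the kernel and reproduction of polynomials\<close>

lemma siac_kernel_moment:
  assumes mono: "mono_on {- int d..2 * int d + 1} t" and m: "m < 2 * d + 1"
  shows "has_bochner_integral lborel (\<lambda>x. siac_kernel d t c x * x ^ m)
    (fact (Suc d) / pochhammer (real (Suc m)) (Suc d) * (M0 d t *\<^sub>v unit_integral_coeffs d t c) $ m)"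
proof -
  let ?C = "pochhammer (real (Suc m)) (Suc d)"
  let ?D = "\<lambda>\<gamma>. divdiff t \<gamma> (Suc d) (\<lambda>s. s ^ (Suc d + m))"
  \<comment> \<open>The quotient by \<open>real d + 1\<close> is absorbed into
    \<open>unit_integral_coeffs\<close>.\<close>
  have F: "fact d = fact (Suc d) / (real d + 1)"
    by (simp add: field_simps)
  have "has_bochner_integral lborel
      (\<lambda>x. \<Sum>\<gamma> = - int d..int d. c $ nat (\<gamma> + int d) * (bspline d t \<gamma> (\<gamma> + int d + 1) x * x ^ m))
      (\<Sum>\<gamma> = - int d..int d. c $ nat (\<gamma> + int d) * ((t (\<gamma> + int d + 1) - t \<gamma>) * fact d / ?C * ?D \<gamma>))"
    by (intro has_bochner_integral_sum has_bochner_integral_mult_right bspline_moment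
        mono_on_int_subinterval[OF mono]) auto
  moreover have "(\<Sum>\<gamma> = - int d..int d. c $ nat (\<gamma> + int d) * ((t (\<gamma> + int d + 1) - t \<gamma>) * fact d / ?C * ?D \<gamma>))
      = (\<Sum>k = 0..<2 * d + 1. fact (Suc d) / ?C * (M0 d t $$ (m, k) * unit_integral_coeffs d t c $ k))"
  proof (rule sum.reindex_bij_witness[of _ "\<lambda>k. int k - int d" "\<lambda>\<gamma>. nat (\<gamma> + int d)"])
    fix \<gamma> assume "\<gamma> \<in> {- int d..int d}"
    then obtain k where k: "k < 2 * d + 1" "nat (\<gamma> + int d) = k" "\<gamma> = int k - int d"
      by (intro that[of "nat (\<gamma> + int d)"]) auto
    have "fact (Suc d) / ?C * (?D \<gamma> * ((t (\<gamma> + int d + 1) - t \<gamma>) / (real d + 1) * c $ k))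
        = c $ k * ((t (\<gamma> + int d + 1) - t \<gamma>) * fact d / ?C * ?D \<gamma>)"
      by (simp add: F mult_ac del: fact_Suc pochhammer_Suc divdiff.simps)
    then show "fact (Suc d) / ?C * (M0 d t $$ (m, nat (\<gamma> + int d)) * unit_integral_coeffs d t c $ nat (\<gamma> + int d))
        = c $ nat (\<gamma> + int d) * ((t (\<gamma> + int d + 1) - t \<gamma>) * fact d / ?C * ?D \<gamma>)"
      using k m by (simp add: M0_def unit_integral_coeffs_def del: pochhammer_Suc divdiff.simps fact_Suc)
  qed auto
  moreover have "(M0 d t *\<^sub>v unit_integral_coeffs d t c) $ m =
      (\<Sum>k = 0..<2 * d + 1. M0 d t $$ (m, k) * unit_integral_coeffs d t c $ k)"
    using m M0_carrier[of d t] unit_integral_coeffs_carrier[of d t c] by (simp add: scalar_prod_def)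
  ultimately show ?thesis
    by (simp only: siac_kernel_def sum_distrib_left sum_distrib_right mult.assoc)
qed

text \<open>Expanding \<open>(x - s) ^ \<delta>\<close> expresses the convolutions through the
  moments. \<open>0 ^ m\<close> is 1 for \<open>m = 0\<close> and 0 otherwise, hence the entries of
  the unit vector.\<close>

lemma convolution_monomials_iff_moments:
  fixes K :: "real \<Rightarrow> real"
  assumes mom: "\<And>m. m \<le> n \<Longrightarrow> has_bochner_integral lborel (\<lambda>s. K s * s ^ m) (\<mu> m)"
  shows "(\<forall>\<delta>\<le>n. \<forall>x. convolution_exists K (\<lambda>s. s ^ \<delta>) x \<and> convolution K (\<lambda>s. s ^ \<delta>) x = x ^ \<delta>)
    \<longleftrightarrow> (\<forall>m\<le>n. \<mu> m = 0 ^ m)"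
proof -
  let ?c = "\<lambda>\<delta> x j. real (\<delta> choose j) * (-1) ^ j * x ^ (\<delta> - j)"
  have "has_bochner_integral lborel (\<lambda>s. K s * (x - s) ^ \<delta>) (\<Sum>j\<le>\<delta>. ?c \<delta> x j * \<mu> j)"
    if "\<delta> \<le> n" for \<delta> x
  proof -
    have "has_bochner_integral lborel (\<lambda>s. \<Sum>j\<le>\<delta>. ?c \<delta> x j * (K s * s ^ j)) (\<Sum>j\<le>\<delta>. ?c \<delta> x j * \<mu> j)"
      using that by (intro has_bochner_integral_sum has_bochner_integral_mult_right mom) auto
    also have "(\<lambda>s. \<Sum>j\<le>\<delta>. ?c \<delta> x j * (K s * s ^ j)) = (\<lambda>s. K s * (x - s) ^ \<delta>)"
    proof
      fix s
      have "(x - s) ^ \<delta> = (\<Sum>j\<le>\<delta>. real (\<delta> choose j) * (- s) ^ j * x ^ (\<delta> - j))"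
        using binomial_ring[of "- s" x \<delta>] by simp
      also have "\<dots> = (\<Sum>j\<le>\<delta>. ?c \<delta> x j * s ^ j)"
        by (intro sum.cong) (auto simp: power_minus[of s])
      finally show "(\<Sum>j\<le>\<delta>. ?c \<delta> x j * (K s * s ^ j)) = K s * (x - s) ^ \<delta>"
        by (simp add: sum_distrib_left algebra_simps)
    qed
    finally show ?thesis .
  qed
  then have conv: "convolution_exists K (\<lambda>s. s ^ \<delta>) x"
      "convolution K (\<lambda>s. s ^ \<delta>) x = (\<Sum>j\<le>\<delta>. ?c \<delta> x j * \<mu> j)" if "\<delta> \<le> n" for \<delta> x
    using that by (auto simp: convolution_exists_def convolution_def has_bochner_integral_iff)
  show ?thesis
  proof (intro iffI allI impI conjI)
    fix m assume conv_eq: "\<forall>\<delta>\<le>n. \<forall>x. convolution_exists K (\<lambda>s. s ^ \<delta>) x \<and> convolution K (\<lambda>s. s ^ \<delta>) x = x ^ \<delta>"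
      and m: "m \<le> n"
    \<comment> \<open>At \<open>x = 0\<close> only the term \<open>j = m\<close> remains; its sign
      is 1 for \<open>m = 0\<close> and harmless when the value is 0.\<close>
    have "0 ^ m = (\<Sum>j\<le>m. ?c m 0 j * \<mu> j)" using conv_eq conv(2)[OF m, of 0] m by auto
    also have "\<dots> = (\<Sum>j\<le>m. if j = m then (-1) ^ m * \<mu> m else 0)"
      by (intro sum.cong) (auto simp: power_0_left)
    also have "\<dots> = (-1) ^ m * \<mu> m" by simp
    finally show "\<mu> m = 0 ^ m" by (cases "m = 0") (auto simp: power_0_left)
  next
    fix \<delta> x assume \<mu>: "\<forall>m\<le>n. \<mu> m = 0 ^ m" and \<delta>: "\<delta> \<le> n"
    have "(\<Sum>j\<le>\<delta>. ?c \<delta> x j * \<mu> j) = (\<Sum>j\<le>\<delta>. if j = 0 then x ^ \<delta> else 0)"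
      using \<mu> \<delta> by (intro sum.cong) (auto simp: power_0_left)
    then show "convolution K (\<lambda>s. s ^ \<delta>) x = x ^ \<delta>" using conv(2)[OF \<delta>] by simp
  qed (use conv in auto)
qed

lemma optimal_siac_coeffs_iff:
  assumes mono: "mono_on {- int d..2 * int d + 1} t" and c: "c \<in> carrier_vec (2 * d + 1)"
  shows "optimal_siac_coeffs d t c \<longleftrightarrow> M0 d t *\<^sub>v unit_integral_coeffs d t c = unit_vec (2 * d + 1) 0"
proof -
  let ?w = "M0 d t *\<^sub>v unit_integral_coeffs d t c"
  let ?\<mu> = "\<lambda>m. fact (Suc d) / pochhammer (real (Suc m)) (Suc d) * ?w $ m"
  have "optimal_siac_coeffs d t c \<longleftrightarrow> (\<forall>m\<le>2 * d. ?\<mu> m = 0 ^ m)"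
    unfolding optimal_siac_coeffs_def
    using c convolution_monomials_iff_moments[of "2 * d", OF siac_kernel_moment[OF mono]]
    by (simp del: fact_Suc pochhammer_Suc)
  also have "\<dots> \<longleftrightarrow> (\<forall>m\<le>2 * d. ?w $ m = 0 ^ m)"
  proof -
    \<comment> \<open>For \<open>m = 0\<close> the factor is exactly 1, as
      \<open>pochhammer 1 (Suc d) = fact (Suc d)\<close>; for other \<open>m\<close> it only has to
      be nonzero.\<close>
    have "?\<mu> m = 0 ^ m \<longleftrightarrow> ?w $ m = 0 ^ m" for m
    proof (cases "m = 0")
      case True
      then show ?thesis by (simp add: pochhammer_fact[symmetric] del: fact_Suc pochhammer_Suc)
    next
      case False
      have "pochhammer (real (Suc m)) (Suc d) \<noteq> 0" by (simp add: pochhammer_eq_0_iff)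
      then show ?thesis using False by (simp add: power_0_left del: fact_Suc pochhammer_Suc)
    qed
    then show ?thesis by simp
  qed
  also have "\<dots> \<longleftrightarrow> ?w = unit_vec (2 * d + 1) 0"
  proof -
    have "dim_vec ?w = 2 * d + 1" using M0_carrier[of d t] by simp
    then show ?thesis
      by (auto simp: vec_eq_iff unit_vec_def power_0_left less_Suc_eq_le)
  qed
  finally show ?thesis .
qed

text \<open>Coinciding end knots give a zero weight in \<open>unit_integral_coeffs\<close>, so the
  rescaling cannot always be undone and the general equivalence concerns the rescaled vector.
  Supports of length \<open>d + 1\<close> make every weight 1.\<close>

theorem theorem3p1:
  fixes d :: nat and t :: "int \<Rightarrow> real"
  assumes "mono_on {- int d..2 * int d + 1} t"
  shows "((\<forall>i\<in>{- int d..<int d}. t i < t (i + int d + 2)) \<longrightarrow> invertible_mat (M0 d t))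
    \<and> (invertible_mat (M0 d t) \<longrightarrow>
        (\<forall>c\<in>carrier_vec (2 * d + 1).
           optimal_siac_coeffs d t c \<longleftrightarrow> unit_integral_coeffs d t c = M0_inv_e1 d t))
    \<and> ((\<forall>\<gamma>\<in>{- int d..int d}. t (\<gamma> + int d + 1) - t \<gamma> = real d + 1) \<longrightarrow>
        invertible_mat (M0 d t) \<and>
        (\<forall>c. optimal_siac_coeffs d t c \<longleftrightarrow> c = M0_inv_e1 d t))"
proof (intro conjI impI)
  show inv: "invertible_mat (M0 d t)" if "\<forall>i\<in>{- int d..<int d}. t i < t (i + int d + 2)"
    using that by (intro invertible_M0[OF assms]) auto
  show iff: "\<forall>c\<in>carrier_vec (2 * d + 1).
      optimal_siac_coeffs d t c \<longleftrightarrow> unit_integral_coeffs d t c = M0_inv_e1 d t"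
    if "invertible_mat (M0 d t)"
    using mult_mat_vec_eq_iff_mat_inverse[OF that M0_carrier unit_integral_coeffs_carrier unit_vec_carrier]
    by (simp add: optimal_siac_coeffs_iff[OF assms] M0_inv_e1_def)
  assume eq: "\<forall>\<gamma>\<in>{- int d..int d}. t (\<gamma> + int d + 1) - t \<gamma> = real d + 1"
  show inv': "invertible_mat (M0 d t)"
  proof (rule inv, rule ballI)
    fix i assume i: "i \<in> {- int d..<int d}"
    then have "t i < t (i + int d + 1)" using bspec[OF eq, of i] by auto
    also have "\<dots> \<le> t (i + int d + 2)" using i by (intro mono_onD[OF assms]) auto
    finally show "t i < t (i + int d + 2)" .
  qed
  show "\<forall>c. optimal_siac_coeffs d t c \<longleftrightarrow> c = M0_inv_e1 d t"
  proof
    fix c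
    show "optimal_siac_coeffs d t c \<longleftrightarrow> c = M0_inv_e1 d t"
    proof (cases "c \<in> carrier_vec (2 * d + 1)")
      case True
      have "t (int k + 1) - t (int k - int d) = real d + 1" if "k < 2 * d + 1" for k
        using bspec[OF eq, of "int k - int d"] that by auto
      then have "unit_integral_coeffs d t c = c"
        using True by (intro eq_vecI) (auto simp: unit_integral_coeffs_def)
      then show ?thesis using iff[OF inv'] True by auto
    next
      case False
      \<comment> \<open>A vector of another length fails both sides: the left by definition, the
        right because the inverse exists and has the size of \<open>M0\<close>.\<close>
      have "M0_inv_e1 d t \<in> carrier_vec (2 * d + 1)"
        unfolding M0_inv_e1_def
        by (rule mult_mat_vec_carrier[OF the_mat_inverse(3)[OF inv' M0_carrier] unit_vec_carrier])
      then show ?thesis using False by (auto simp: optimal_siac_coeffs_def)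
    qed
  qed
qed

end
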